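(* Let $h$ and $d$ be positive integers and let $C_{h,d}=\langle a\mid a^{h}=a^{h+d}\rangle$ be the finite cyclic semigroup of index $h$ and period $d$. Consider the following identities, in which $x,y,x_1,x_2,\dots$ are pairwise distinct letters: \[ xy=yx, \tag{Com} \] \[ \Phi_{h,d}:\quad x^{d}x_1\cdots x_h=x_1\cdots x_h, \] and, when $h>d+2$, for each integer $r$ with $1\le r\le\left\lfloor\frac{h-d}{3}\right\rfloor$, \[ \Psi_{h,d,r}:\quad x^{r}y^{r+d}x_1\cdots x_{h-3r-d}=x^{r+d}y^{r}x_1\cdots x_{h-3r-d} \] (if $h-3r-d=0$, the product $x_1\cdots x_{h-3r-d}$ is the empty word). If $h\le d+2$, then the system consisting of (Com) and $\Phi_{h,d}$ is an identity basis for $C_{h,d}$. If $h>d+2$, then the system consisting of (Com), $\Phi_{h,d}$, and all the identities $\Psi_{h,d,r}$ with $r=1,\dots,\left\lfloor\frac{h-d}{3}\right\rfloor$ is an identity basis for $C_{h,d}$.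
   Context: Semigroups are not assumed to have an identity element. $C_{h,d}=\langle a\mid a^{h}=a^{h+d}\rangle$ is a semigroup presentation: $C_{h,d}$ consists of the $h+d-1$ distinct elements $a,a^2,\dots,a^{h+d-1}$, with $a^ia^j=a^{i+j}$, exponents being reduced by means of $a^{h+d}=a^{h}$. Fix a countably infinite set $X=\{x,y,x_1,x_2,\dots\}$ of letters. A word is a finite sequence of letters from $X$; the empty word is allowed. A substitution into a semigroup $S$ is a map $\varphi\colon X\to S$; the value of a non-empty word $w=z_1\cdots z_\ell$ (with $z_i$ letters) under $\varphi$ is $w\varphi=(z_1\varphi)\cdots(z_\ell\varphi)$. An identity is an expression $u=v$ with $u,v$ non-empty words. A semigroup $S$ satisfies $u=v$ (equivalently, $u=v$ holds in $S$) if $u\varphi=v\varphi$ for every substitution $\varphi\colon X\to S$. Given a system $\Sigma$ of identities, its consequences are the identities that can be deduced from $\Sigma$ by repeatedly applying the following rules: substituting non-empty words for letters (the same word for every occurrence of a given letter) in an identity, multiplying both sides of an identity on the left or on the right by a word, and using reflexivity, symmetry and transitivity of equality. A system $\Sigma$ of identities holding in a semigroup $S$ (that is, every identity of $\Sigma$ holds in $S$) is called an identity basis for $S$ if every identity satisfied by $S$ is a consequence of $\Sigma$. *)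

theory Defs
  imports Main
begin

section \<open>Semigroups on an explicit carrier\<close>

record 'a sgrp =
  elems :: "'a set"
  mul :: "'a \<Rightarrow> 'a \<Rightarrow> 'a"

definition is_semigroup :: "'a sgrp \<Rightarrow> bool" where
  "is_semigroup S \<longleftrightarrow>
     (\<forall>a\<in>elems S. \<forall>b\<in>elems S. mul S a b \<in> elems S) \<and>
     (\<forall>a\<in>elems S. \<forall>b\<in>elems S. \<forall>c\<in>elems S.
        mul S (mul S a b) c = mul S a (mul S b c))"


section \<open>Words, identities and their consequences\<close>

text \<open>\<open>X\<close>, \<open>Y\<close> and \<open>Z i\<close> are the letters \<open>x\<close>, \<open>y\<close> and \<open>x\<^sub>i\<close>; \<open>Z 0\<close> is just one more letter.\<close>

datatype letter = X | Y | Z nat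

type_synonym word = "letter list"

text \<open>An identity \<open>u = v\<close> is the pair \<open>(u, v)\<close>; both sides must be non-empty.\<close>

type_synonym identity = "word \<times> word"

definition is_identity :: "identity \<Rightarrow> bool" where
  "is_identity e \<longleftrightarrow> fst e \<noteq> [] \<and> snd e \<noteq> []"

text \<open>The empty word has no value in a semigroup.\<close>

fun word_value :: "'a sgrp \<Rightarrow> (letter \<Rightarrow> 'a) \<Rightarrow> word \<Rightarrow> 'a" where
  "word_value S \<phi> [] = undefined"
| "word_value S \<phi> [z] = \<phi> z"
| "word_value S \<phi> (z # z' # w) = mul S (\<phi> z) (word_value S \<phi> (z' # w))"

definition satisfies :: "'a sgrp \<Rightarrow> identity \<Rightarrow> bool" where
  "satisfies S e \<longleftrightarrow>
     (\<forall>\<phi>. (\<forall>z. \<phi> z \<in> elems S) \<longrightarrow> word_value S \<phi> (fst e) = word_value S \<phi> (snd e))"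

definition subst_word :: "(letter \<Rightarrow> word) \<Rightarrow> word \<Rightarrow> word" where
  "subst_word \<sigma> w = concat (map \<sigma> w)"

inductive_set consequences :: "identity set \<Rightarrow> identity set" for \<Sigma> :: "identity set" where
  base: "(u, v) \<in> \<Sigma> \<Longrightarrow> (u, v) \<in> consequences \<Sigma>"
| subst: "(u, v) \<in> consequences \<Sigma> \<Longrightarrow> (\<And>z. \<sigma> z \<noteq> []) \<Longrightarrow>
    (subst_word \<sigma> u, subst_word \<sigma> v) \<in> consequences \<Sigma>"
| mult_left: "(u, v) \<in> consequences \<Sigma> \<Longrightarrow> (w @ u, w @ v) \<in> consequences \<Sigma>"
| mult_right: "(u, v) \<in> consequences \<Sigma> \<Longrightarrow> (u @ w, v @ w) \<in> consequences \<Sigma>"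
| refl: "u \<noteq> [] \<Longrightarrow> (u, u) \<in> consequences \<Sigma>"
| sym: "(u, v) \<in> consequences \<Sigma> \<Longrightarrow> (v, u) \<in> consequences \<Sigma>"
| trans: "(u, v) \<in> consequences \<Sigma> \<Longrightarrow> (v, w) \<in> consequences \<Sigma> \<Longrightarrow>
    (u, w) \<in> consequences \<Sigma>"

definition identity_basis :: "'a sgrp \<Rightarrow> identity set \<Rightarrow> bool" where
  "identity_basis S \<Sigma> \<longleftrightarrow>
     (\<forall>e\<in>\<Sigma>. is_identity e \<and> satisfies S e) \<and>
     (\<forall>e. is_identity e \<and> satisfies S e \<longrightarrow> e \<in> consequences \<Sigma>)"


section \<open>The cyclic semigroup of index \<open>h\<close> and period \<open>d\<close>\<close>

definition reduce_exp :: "nat \<Rightarrow> nat \<Rightarrow> nat \<Rightarrow> nat" where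
  "reduce_exp h d n = (if n < h then n else h + (n - h) mod d)"

text \<open>The element \<open>a\<^sup>i\<close> is represented by its reduced exponent \<open>i\<close>, \<open>1 \<le> i \<le> h + d - 1\<close>.\<close>

definition cyclic_semigroup :: "nat \<Rightarrow> nat \<Rightarrow> nat sgrp" where
  "cyclic_semigroup h d =
     \<lparr>elems = {1..h + d - 1}, mul = (\<lambda>i j. reduce_exp h d (i + j))\<rparr>"

lemma reduce_exp_eq_iff:
  assumes "0 < d"
  shows "reduce_exp h d m = reduce_exp h d n \<longleftrightarrow>
    m = n \<or> h \<le> m \<and> h \<le> n \<and> m mod d = n mod d"
proof (cases "h \<le> m \<and> h \<le> n")
  case True
  then obtain i j where ij: "m = h + i" "n = h + j"
    using le_Suc_ex by blast
  have "(h + i) mod d = (h + j) mod d \<longleftrightarrow> i mod d = j mod d"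
    by (simp add: nat_mod_eq_iff add.assoc)
  then show ?thesis
    using ij by (auto simp: reduce_exp_def)
qed (auto simp: reduce_exp_def)

lemma reduce_exp_reduced:
  "n < h + d \<Longrightarrow> reduce_exp h d n = n"
  by (simp add: reduce_exp_def)

lemma reduce_exp_mem:
  assumes "0 < d" "0 < h" "0 < n"
  shows "reduce_exp h d n \<in> {1..h + d - 1}"
proof -
  have "(n - h) mod d < d" using assms by simp
  then have "h + (n - h) mod d \<le> h + d - 1" by linarith
  then show ?thesis using assms unfolding reduce_exp_def by auto
qed

lemma reduce_exp_add:
  assumes "0 < d"
  shows "reduce_exp h d (reduce_exp h d m + n) = reduce_exp h d (m + n)"
proof (cases "m < h")
  case True
  then show ?thesis by (simp add: reduce_exp_def)
next
  case False
  then obtain k where k: "m = h + k" using le_Suc_ex not_less by blast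
  have "(h + k mod d + n) mod d = (h + k + n) mod d"
    using mod_add_left_eq[of k d "h + n"] by (simp add: ac_simps)
  then show ?thesis
    using assms by (subst reduce_exp_eq_iff) (auto simp: k reduce_exp_def)
qed

lemma is_semigroup_cyclic:
  assumes "0 < h" "0 < d"
  shows "is_semigroup (cyclic_semigroup h d)"
  using reduce_exp_mem[OF assms(2,1)] reduce_exp_add[OF assms(2)]
  unfolding is_semigroup_def cyclic_semigroup_def
  by (simp add: add.commute add.left_commute)


section \<open>The identities\<close>

text \<open>The word \<open>x\<^sub>1 \<dots> x\<^sub>n\<close>; it is empty for \<open>n = 0\<close>.\<close>

definition xs_word :: "nat \<Rightarrow> word" where
  "xs_word n = map Z [1..<n + 1]"

definition Com :: identity where
  "Com = ([X, Y], [Y, X])"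

definition Phi :: "nat \<Rightarrow> nat \<Rightarrow> identity" where
  "Phi h d = (replicate d X @ xs_word h, xs_word h)"

text \<open>Only used for \<open>3 * r + d \<le> h\<close>, where the subtraction is not truncated.\<close>

definition Psi :: "nat \<Rightarrow> nat \<Rightarrow> nat \<Rightarrow> identity" where
  "Psi h d r =
     (replicate r X @ replicate (r + d) Y @ xs_word (h - 3 * r - d),
      replicate (r + d) X @ replicate r Y @ xs_word (h - 3 * r - d))"

end

theory Submission
  imports Defs "HOL-Library.Multiset"
begin

text \<open>
  Write \<open>u\<^sub>z\<close> for the number of occurrences of a letter \<open>z\<close> in a word \<open>u\<close>, and \<open>|u|\<close> for the length
  of \<open>u\<close>. Sending each letter \<open>z\<close> to a power \<open>a\<^bsup>\<psi> z\<^esup>\<close> turns \<open>u\<close> into \<open>a\<close> to the power of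
  \<open>\<Sum>z. u\<^sub>z * \<psi> z\<close>, so \<open>u = v\<close> holds in the cyclic semigroup iff for every positive \<open>\<psi>\<close> the two
  weighted sums are equal, or are both at least \<open>h\<close> and congruent modulo \<open>d\<close>. Only two kinds of
  weights matter: the constant \<open>1\<close>, and the weights that are \<open>2\<close> at a single letter and \<open>1\<close>
  elsewhere. They yield (lemmas \<open>satisfies_length\<close>, \<open>satisfies_count\<close>, \<open>satisfies_cong\<close>) that all
  \<open>u\<^sub>z\<close> and \<open>v\<^sub>z\<close> are congruent modulo \<open>d\<close>, and that one of two cases occurs.

  \<^item> Both words have length at least \<open>h\<close>. Then \<open>\<Phi>\<close> allows adding \<open>d\<close> copies of any letter to
    either word, which raises both to the same multiset, the one with entries \<open>max u\<^sub>z v\<^sub>z\<close>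
    (lemma \<open>long_words\<close>).

  \<^item> \<open>|u| = |v| = h - r\<close> with \<open>r \<ge> 1\<close>, and \<open>u\<^sub>z, v\<^sub>z \<ge> r\<close> whenever \<open>u\<^sub>z \<noteq> v\<^sub>z\<close>. If the words
    are not rearrangements of each other, then, having the same length, they have letters with
    \<open>u\<^sub>z > v\<^sub>z \<ge> r\<close> and \<open>v\<^sub>t > u\<^sub>t \<ge> r\<close>. By the congruences \<open>u\<^sub>z \<ge> r + d\<close>, so \<open>u\<close> contains
    \<open>z\<^bsup>r + d\<^esup> t\<^sup>r\<close>, and what is left has exactly the length \<open>h - 3 * r - d\<close> of the tail in \<open>\<Psi>\<close>.
    In particular \<open>3 * r + d \<le> h\<close>: this is the range of \<open>r\<close> in the basis, and it is empty when
    \<open>h \<le> d + 2\<close>. Applying \<open>\<Psi>\<close> trades \<open>d\<close> copies of \<open>z\<close> for \<open>d\<close> copies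
    of \<open>t\<close>, which brings \<open>u\<close> closer to \<open>v\<close> and keeps all the conditions (lemma \<open>short_words\<close>).
\<close>


section \<open>Identities of the cyclic semigroup\<close>

lemma word_value_cyclic:
  assumes "0 < d" and "w \<noteq> []"
  shows "word_value (cyclic_semigroup h d) (\<lambda>z. reduce_exp h d (\<psi> z)) w
    = reduce_exp h d (sum_list (map \<psi> w))"
  using assms(2)
proof (induction w rule: induct_list012)
  case (3 z z' w)
  have "reduce_exp h d (reduce_exp h d m + reduce_exp h d n) = reduce_exp h d (m + n)" for m n
    using reduce_exp_add[OF assms(1)] by (metis add.commute)
  with 3 show ?case by (simp add: cyclic_semigroup_def)
qed auto

text \<open>Arbitrary positive exponents may be used in place of reduced ones; this avoids having to
  check whether the exponent \<open>2\<close> is reduced, which fails in the trivial semigroup.\<close>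

lemma satisfies_cyclic_iff:
  assumes "0 < h" and "0 < d" and "u \<noteq> []" and "v \<noteq> []"
  shows "satisfies (cyclic_semigroup h d) (u, v) \<longleftrightarrow>
    (\<forall>\<psi>. (\<forall>z. 0 < \<psi> z) \<longrightarrow>
      reduce_exp h d (sum_list (map \<psi> u)) = reduce_exp h d (sum_list (map \<psi> v)))"
    (is "?S \<longleftrightarrow> ?R")
proof
  assume S: ?S
  show ?R
  proof (intro allI impI)
    fix \<psi> :: "letter \<Rightarrow> nat"
    assume "\<forall>z. 0 < \<psi> z"
    then have "\<forall>z. reduce_exp h d (\<psi> z) \<in> elems (cyclic_semigroup h d)"
      using reduce_exp_mem[OF assms(2,1)] by (simp add: cyclic_semigroup_def)
    with S have "word_value (cyclic_semigroup h d) (\<lambda>z. reduce_exp h d (\<psi> z)) u =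
        word_value (cyclic_semigroup h d) (\<lambda>z. reduce_exp h d (\<psi> z)) v"
      unfolding satisfies_def fst_conv snd_conv by (metis (no_types))
    then show "reduce_exp h d (sum_list (map \<psi> u)) = reduce_exp h d (sum_list (map \<psi> v))"
      using assms(3,4) by (simp only: word_value_cyclic[OF assms(2)] not_False_eq_True)
  qed
next
  assume R: ?R
  show ?S
    unfolding satisfies_def
  proof (intro allI impI)
    fix \<phi> :: "letter \<Rightarrow> nat"
    assume "\<forall>z. \<phi> z \<in> elems (cyclic_semigroup h d)"
    then have "\<phi> z \<in> {1..h + d - 1}" for z by (simp add: cyclic_semigroup_def)
    then have el: "0 < \<phi> z \<and> \<phi> z < h + d" for z
      using assms(1) by (metis One_nat_def Suc_le_eq Suc_pred add_gr_0 atLeastAtMost_iff less_Suc_eq_le)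
    then have "(\<lambda>z. reduce_exp h d (\<phi> z)) = \<phi>"
      by (simp add: reduce_exp_reduced)
    then show "word_value (cyclic_semigroup h d) \<phi> (fst (u, v)) =
        word_value (cyclic_semigroup h d) \<phi> (snd (u, v))"
      using R el word_value_cyclic[OF assms(2), of _ h \<phi>] assms(3,4) by simp
  qed
qed

lemma length_le_sum_list:
  assumes "\<And>z. 0 < (\<psi> z :: nat)"
  shows "length w \<le> sum_list (map \<psi> w)"
  using sum_list_mono[of w "\<lambda>_. 1" \<psi>] assms by (simp add: Suc_le_eq sum_list_triv)

lemma length_xs_word [simp]: "length (xs_word n) = n"
  by (simp add: xs_word_def)

lemma satisfies_Com:
  assumes "0 < h" and "0 < d"
  shows "satisfies (cyclic_semigroup h d) Com"
  using assms by (simp add: Com_def satisfies_cyclic_iff add.commute)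

lemma satisfies_Phi:
  assumes "0 < h" and "0 < d"
  shows "satisfies (cyclic_semigroup h d) (Phi h d)"
proof -
  have "xs_word h \<noteq> []"
    using assms(1) length_xs_word[of h] by (metis length_0_conv less_irrefl)
  moreover have "h \<le> sum_list (map \<psi> (xs_word h))" if "\<forall>z. 0 < \<psi> z" for \<psi>
    using that length_le_sum_list[of \<psi> "xs_word h"] by simp
  ultimately show ?thesis
    using assms
    by (simp add: Phi_def satisfies_cyclic_iff reduce_exp_eq_iff sum_list_replicate trans_le_add2)
qed

lemma satisfies_Psi:
  assumes "0 < h" and "0 < d" and "0 < r" and "3 * r + d \<le> h"
  shows "satisfies (cyclic_semigroup h d) (Psi h d r)"
proof -
  have "reduce_exp h d (r * x + ((r + d) * y + s)) = reduce_exp h d ((r + d) * x + (r * y + s))"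
    if "0 < x" "0 < y" "h - 3 * r - d \<le> s" for x y s
  proof (cases "x = y")
    case False
    \<comment> \<open>Two different weights add up to at least \<open>3\<close>, which is just enough for both exponents to
      reach \<open>h\<close>.\<close>
    with that have "3 \<le> x + y" by linarith
    then have "r * 3 \<le> r * (x + y)" by (rule mult_le_mono2)
    then have "3 * r \<le> r * x + r * y" by (simp add: add_mult_distrib2)
    moreover have "d \<le> d * x" "d \<le> d * y" using that by simp_all
    ultimately have "h \<le> r * x + ((r + d) * y + s)" "h \<le> (r + d) * x + (r * y + s)"
      using that(3) assms(4) unfolding add_mult_distrib by linarith+
    moreover have "(r * x + ((r + d) * y + s)) mod d = ((r + d) * x + (r * y + s)) mod d"
    proof -
      have "(r * x + ((r + d) * y + s)) = (r * x + r * y + s) + y * d"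
        and "((r + d) * x + (r * y + s)) = (r * x + r * y + s) + x * d"
        by (simp_all add: algebra_simps)
      then show ?thesis by (metis mod_mult_self1)
    qed
    ultimately show ?thesis using assms(2) by (simp add: reduce_exp_eq_iff)
  qed (simp add: algebra_simps)
  moreover have "h - 3 * r - d \<le> sum_list (map \<psi> (xs_word (h - 3 * r - d)))"
    if "\<forall>z. 0 < \<psi> z" for \<psi>
    using that length_le_sum_list[of \<psi> "xs_word (h - 3 * r - d)"] by simp
  ultimately show ?thesis
    using assms by (simp add: Psi_def satisfies_cyclic_iff sum_list_replicate)
qed

lemma satisfies_length:
  assumes "0 < h" and "0 < d" and "u \<noteq> []" and "v \<noteq> []"
    and "satisfies (cyclic_semigroup h d) (u, v)"
  shows "reduce_exp h d (length u) = reduce_exp h d (length v)"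
  using assms(5) unfolding satisfies_cyclic_iff[OF assms(1-4)]
  by (auto dest: spec[of _ "\<lambda>_. 1"] simp: sum_list_triv)

text \<open>Giving one letter the weight \<open>2\<close> adds its number of occurrences to the length.\<close>

lemma satisfies_count:
  assumes "0 < h" and "0 < d" and "u \<noteq> []" and "v \<noteq> []"
    and "satisfies (cyclic_semigroup h d) (u, v)"
  shows "reduce_exp h d (length u + count (mset u) z) = reduce_exp h d (length v + count (mset v) z)"
proof -
  define \<psi> where "\<psi> = (\<lambda>t. if t = z then 2 else 1 :: nat)"
  have sum: "sum_list (map \<psi> w) = length w + count (mset w) z" for w
    by (induction w) (auto simp: \<psi>_def)
  have "\<forall>t. 0 < \<psi> t" by (simp add: \<psi>_def)
  with assms(5) show ?thesis
    unfolding satisfies_cyclic_iff[OF assms(1-4)] by (metis sum)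
qed

lemma reduce_exp_eq_imp_mod_eq:
  "0 < d \<Longrightarrow> reduce_exp h d m = reduce_exp h d n \<Longrightarrow> m mod d = n mod d"
  by (auto simp: reduce_exp_eq_iff)

lemma satisfies_cong:
  assumes "0 < h" and "0 < d" and "u \<noteq> []" and "v \<noteq> []"
    and "satisfies (cyclic_semigroup h d) (u, v)"
  shows "count (mset u) z mod d = count (mset v) z mod d"
proof -
  have "length u mod d = length v mod d"
    using reduce_exp_eq_imp_mod_eq[OF assms(2) satisfies_length[OF assms]] .
  then have "(length v + count (mset v) z) mod d = (length u + count (mset v) z) mod d"
    by (metis mod_add_left_eq)
  moreover have "(length u + count (mset u) z) mod d = (length v + count (mset v) z) mod d"
    using reduce_exp_eq_imp_mod_eq[OF assms(2) satisfies_count[OF assms]] .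
  ultimately have "(length u + count (mset u) z) mod d = (length u + count (mset v) z) mod d"
    by simp
  then show ?thesis by (simp add: nat_mod_eq_iff add.assoc)
qed


section \<open>Deductions\<close>

lemma consequences_commute:
  assumes "Com \<in> \<Sigma>" and "p \<noteq> []" and "q \<noteq> []"
  shows "(p @ q, q @ p) \<in> consequences \<Sigma>"
proof -
  define \<sigma> where "\<sigma> = (\<lambda>z. if z = X then p else q)"
  have "(subst_word \<sigma> [X, Y], subst_word \<sigma> [Y, X]) \<in> consequences \<Sigma>"
    using assms by (intro consequences.subst consequences.base) (auto simp: Com_def \<sigma>_def)
  then show ?thesis by (simp add: subst_word_def \<sigma>_def)
qed

lemma consequences_perm:
  assumes "Com \<in> \<Sigma>" and "mset u = mset v" and "u \<noteq> []"
  shows "(u, v) \<in> consequences \<Sigma>"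
  using assms(2,3)
proof (induction u arbitrary: v)
  case (Cons a u)
  then have "a \<in> set v" by (metis list.set_intros(1) set_mset_mset)
  then obtain p q where v: "v = p @ a # q" by (meson split_list)
  have "(a # u, a # p @ q) \<in> consequences \<Sigma>"
  proof (cases "u = []")
    case True
    with Cons.prems v show ?thesis by (simp add: consequences.refl)
  next
    case False
    moreover have "mset u = mset (p @ q)" using Cons.prems(1) v by simp
    ultimately have "(u, p @ q) \<in> consequences \<Sigma>" using Cons.IH by blast
    then show ?thesis using consequences.mult_left[of u "p @ q" \<Sigma> "[a]"] by simp
  qed
  moreover have "(a # p @ q, v) \<in> consequences \<Sigma>"
  proof (cases "p = []")
    case True
    with v show ?thesis by (simp add: consequences.refl)
  next
    case False
    then have "([a] @ p, p @ [a]) \<in> consequences \<Sigma>"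
      using consequences_commute[OF assms(1)] by blast
    then show ?thesis using consequences.mult_right[of "[a] @ p" "p @ [a]" \<Sigma> q] v by simp
  qed
  ultimately show ?case by (rule consequences.trans)
qed simp

text \<open>The letters \<open>x\<^sub>1, \<dots>, x\<^sub>n\<close> of the identities stand for the letters of an arbitrary word.\<close>

lemma subst_xs_word:
  "subst_word (\<lambda>z. case z of Z i \<Rightarrow> [w ! (i - 1)] | _ \<Rightarrow> f z) (xs_word (length w)) = w"
proof -
  have "xs_word (length w) = map (\<lambda>i. Z (Suc i)) [0..<length w]"
    by (simp add: xs_word_def map_Suc_upt[symmetric] comp_def del: map_Suc_upt upt_Suc)
  then show ?thesis by (simp add: subst_word_def comp_def concat_map_singleton map_nth)
qed

lemma subst_word_append [simp]: "subst_word \<sigma> (u @ v) = subst_word \<sigma> u @ subst_word \<sigma> v"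
  by (simp add: subst_word_def)

lemma subst_word_replicate: "\<sigma> z = [t] \<Longrightarrow> subst_word \<sigma> (replicate n z) = replicate n t"
  by (induction n) (simp_all add: subst_word_def)

lemma consequences_Phi:
  assumes "Phi h d \<in> \<Sigma>" and "h \<le> length w"
  shows "(replicate d z @ w, w) \<in> consequences \<Sigma>"
proof -
  define p where "p = take h w"
  define \<sigma> where "\<sigma> = (\<lambda>t. case t of Z i \<Rightarrow> [p ! (i - 1)] | _ \<Rightarrow> [z])"
  have p: "length p = h" using assms(2) by (simp add: p_def)
  have "(subst_word \<sigma> (replicate d X @ xs_word h), subst_word \<sigma> (xs_word h)) \<in> consequences \<Sigma>"
    using assms(1)
    by (intro consequences.subst consequences.base) (auto simp: Phi_def \<sigma>_def split: letter.splits)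
  moreover have "subst_word \<sigma> (xs_word h) = p"
    using subst_xs_word[where w = p and f = "\<lambda>_. [z]"] unfolding \<sigma>_def p .
  moreover have "subst_word \<sigma> (replicate d X) = replicate d z"
    by (rule subst_word_replicate) (simp add: \<sigma>_def)
  ultimately have "(replicate d z @ p, p) \<in> consequences \<Sigma>" by simp
  then have "((replicate d z @ p) @ drop h w, p @ drop h w) \<in> consequences \<Sigma>"
    by (rule consequences.mult_right)
  then show ?thesis by (simp add: p_def)
qed

lemma consequences_Psi:
  assumes "Psi h d r \<in> \<Sigma>" and "length w = h - 3 * r - d"
  shows "(replicate r z @ replicate (r + d) t @ w, replicate (r + d) z @ replicate r t @ w)
    \<in> consequences \<Sigma>"
proof -
  define \<sigma> where "\<sigma> = (\<lambda>s. case s of Z i \<Rightarrow> [w ! (i - 1)] | _ \<Rightarrow> if s = X then [z] else [t])"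
  have "(subst_word \<sigma> (replicate r X @ replicate (r + d) Y @ xs_word (length w)),
      subst_word \<sigma> (replicate (r + d) X @ replicate r Y @ xs_word (length w))) \<in> consequences \<Sigma>"
    using assms
    by (intro consequences.subst consequences.base) (auto simp: Psi_def \<sigma>_def split: letter.splits)
  moreover have "subst_word \<sigma> (xs_word (length w)) = w"
    using subst_xs_word[where w = w and f = "\<lambda>s. if s = X then [z] else [t]"] unfolding \<sigma>_def .
  moreover have "subst_word \<sigma> (replicate n X) = replicate n z"
    and "subst_word \<sigma> (replicate n Y) = replicate n t" for n
    by (simp_all add: subst_word_replicate \<sigma>_def)
  ultimately show ?thesis by simp
qed


section \<open>Deducing the identities of the cyclic semigroup\<close>

lemma less_cong_imp_add_le:
  fixes m n d :: nat
  assumes "m < n" and "m mod d = n mod d"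
  shows "m + d \<le> n"
proof -
  have "d dvd n - m" using assms mod_eq_dvd_iff_nat[of m n d] by simp
  then have "d \<le> n - m" using assms(1) by (simp add: dvd_imp_le)
  with assms(1) show ?thesis by linarith
qed

lemma long_words_subset:
  assumes "Com \<in> \<Sigma>" and "Phi h d \<in> \<Sigma>" and "0 < h" and "0 < d"
    and "mset u \<subseteq># mset v" and "h \<le> length u"
    and "\<And>z. count (mset u) z mod d = count (mset v) z mod d"
  shows "(u, v) \<in> consequences \<Sigma>"
  using assms(5-)
proof (induction "length v - length u" arbitrary: u rule: less_induct)
  case less
  show ?case
  proof (cases "mset u = mset v")
    case True
    moreover have "u \<noteq> []" using less.prems(2) assms(3) by auto
    ultimately show ?thesis using consequences_perm[OF assms(1)] by blast
  next
    case False
    then obtain z where "count (mset u) z \<noteq> count (mset v) z" by (meson multiset_eqI)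
    then have "count (mset u) z < count (mset v) z"
      using less.prems(1) by (meson mset_subset_eq_count nat_less_le)
    then have z: "count (mset u) z + d \<le> count (mset v) z"
      using less_cong_imp_add_le less.prems(3) by blast
    define u' where "u' = replicate d z @ u"
    have sub: "mset u' \<subseteq># mset v"
      using z less.prems(1) by (auto simp: subseteq_mset_def u'_def)
    have "length u' \<le> length v" using size_mset_mono[OF sub] by simp
    then have "length v - length u' < length v - length u"
      using assms(4) by (simp add: u'_def)
    moreover have "h \<le> length u'" using less.prems(2) by (simp add: u'_def)
    moreover have "count (mset u') t mod d = count (mset v) t mod d" for t
      using less.prems(3)[of t] by (auto simp: u'_def)
    ultimately have "(u', v) \<in> consequences \<Sigma>" using less.hyps sub by blast
    moreover have "(u, u') \<in> consequences \<Sigma>"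
      using consequences_Phi[OF assms(2) less.prems(2)] consequences.sym by (simp add: u'_def)
    ultimately show ?thesis using consequences.trans by blast
  qed
qed

lemma long_words:
  assumes "Com \<in> \<Sigma>" and "Phi h d \<in> \<Sigma>" and "0 < h" and "0 < d"
    and "h \<le> length u" and "h \<le> length v"
    and "\<And>z. count (mset u) z mod d = count (mset v) z mod d"
  shows "(u, v) \<in> consequences \<Sigma>"
proof -
  obtain w where w: "mset w = mset u \<union># mset v" by (meson ex_mset)
  have "count (mset w) z mod d = count (mset u) z mod d" for z
    using assms(7)[of z] by (simp add: w max_def)
  then have "(u, w) \<in> consequences \<Sigma>" "(v, w) \<in> consequences \<Sigma>"
    using assms w by (auto intro!: long_words_subset[OF assms(1-4)])
  then show ?thesis using consequences.sym consequences.trans by blast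
qed

lemma mset_excess:
  assumes "length u = length v" and "mset u \<noteq> mset v"
  obtains z where "count (mset v) z < count (mset u) z"
proof -
  have "\<not> mset u \<subseteq># mset v"
  proof
    assume "mset u \<subseteq># mset v"
    then have "mset u \<subset># mset v" using assms(2) by (simp add: subset_mset.less_le)
    then have "size (mset u) < size (mset v)" by (rule mset_subset_size)
    with assms(1) show False by simp
  qed
  then show ?thesis using that by (auto simp: subseteq_mset_def not_le)
qed

text \<open>Trading \<open>d\<close> copies of a letter that \<open>u\<close> has in excess for \<open>d\<close> copies of a letter that it
  lacks never overshoots, since the numbers of occurrences are congruent modulo \<open>d\<close>; hence the
  bound \<open>r\<close> survives each trade. The words themselves force \<open>3 * r + d \<le> h\<close> as soon as a trade
  is needed, so \<open>\<Psi>\<close> is assumed only under this condition, and the lemma covers both ranges of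
  \<open>h\<close> at once.\<close>

lemma short_words:
  assumes "Com \<in> \<Sigma>" and "0 < d" and "0 < r"
    and Psi: "3 * r + d \<le> h \<Longrightarrow> Psi h d r \<in> \<Sigma>"
    and "u \<noteq> []" and "length u + r = h" and "length v + r = h"
    and "\<And>z. count (mset u) z mod d = count (mset v) z mod d"
    and "\<And>z. count (mset u) z \<noteq> count (mset v) z \<Longrightarrow>
      r \<le> count (mset u) z \<and> r \<le> count (mset v) z"
  shows "(u, v) \<in> consequences \<Sigma>"
  using assms(5-)
proof (induction "size (mset u - mset v)" arbitrary: u rule: less_induct)
  case less
  note cong = less.prems(4) and large = less.prems(5)
  show ?case
  proof (cases "mset u = mset v")
    case True
    then show ?thesis using consequences_perm[OF assms(1)] less.prems(1) by blast
  next
    case False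
    have len: "length u = length v" using less.prems(2,3) by linarith
    obtain z where z: "count (mset v) z < count (mset u) z"
      using mset_excess[OF len False] .
    obtain t where t: "count (mset u) t < count (mset v) t"
      using mset_excess[OF len[symmetric] False[symmetric]] .
    have zt: "z \<noteq> t" using z t by auto
    have zd: "count (mset v) z + d \<le> count (mset u) z"
      using less_cong_imp_add_le[OF z] cong by simp
    have td: "count (mset u) t + d \<le> count (mset v) t"
      using less_cong_imp_add_le[OF t] cong by simp
    have "replicate_mset (r + d) z + replicate_mset r t \<subseteq># mset u"
      using zd zt large[of z] large[of t] z t by (auto simp: subseteq_mset_def)
    then obtain R where R: "mset u = replicate_mset (r + d) z + replicate_mset r t + R"
      by (auto simp: mset_subset_eq_exists_conv)
    obtain w where w: "mset w = R" by (meson ex_mset)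
    have lu: "length u = 2 * r + d + length w"
      using arg_cong[OF R, of size] w by (auto simp flip: size_mset)
    with less.prems(2) have le: "3 * r + d \<le> h" and lw: "length w = h - 3 * r - d"
      by linarith+
    define u' where "u' = replicate r z @ replicate (r + d) t @ w"
    have mu': "mset u' + replicate_mset d z = mset u + replicate_mset d t"
      by (rule multiset_eqI) (simp add: u'_def R w)
    have count': "count (mset u') s + (if s = z then d else 0)
        = count (mset u) s + (if s = t then d else 0)" for s
      using arg_cong[OF mu', of "\<lambda>M. count M s"] by simp
    have "(u, replicate (r + d) z @ replicate r t @ w) \<in> consequences \<Sigma>"
      using less.prems(1) by (intro consequences_perm[OF assms(1)]) (simp_all add: R w)
    moreover have "(replicate (r + d) z @ replicate r t @ w, u') \<in> consequences \<Sigma>"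
      unfolding u'_def by (rule consequences.sym[OF consequences_Psi[OF Psi[OF le] lw]])
    moreover have "(u', v) \<in> consequences \<Sigma>"
    proof (rule less.hyps)
      have "mset u - mset v = mset u' - mset v + replicate_mset d z"
      proof (rule multiset_eqI)
        fix s
        show "count (mset u - mset v) s = count (mset u' - mset v + replicate_mset d z) s"
          using count'[of s] zd td zt by (cases "s = z"; cases "s = t") simp_all
      qed
      then show "size (mset u' - mset v) < size (mset u - mset v)"
        using assms(2) by simp
      show "u' \<noteq> []" using assms(2) by (simp add: u'_def)
      show "length u' + r = h" using lu less.prems(2) by (simp add: u'_def)
      show "length v + r = h" by (rule less.prems(3))
      fix s
      show "count (mset u') s mod d = count (mset v) s mod d"
        using arg_cong[OF count'[of s], of "\<lambda>n. n mod d"] cong[of s] by (simp split: if_splits)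
      show "r \<le> count (mset u') s \<and> r \<le> count (mset v) s"
        if "count (mset u') s \<noteq> count (mset v) s"
        using that count'[of s] large[of s] large[of z] large[of t] z t zd td zt
        by (cases "s = z"; cases "s = t") auto
    qed
    ultimately show ?thesis using consequences.trans by blast
  qed
qed

lemma satisfies_imp_consequence:
  assumes h: "0 < h" and d: "0 < d" and Com: "Com \<in> \<Sigma>" and Phi: "Phi h d \<in> \<Sigma>"
    and Psi: "\<And>r. 0 < r \<Longrightarrow> 3 * r + d \<le> h \<Longrightarrow> Psi h d r \<in> \<Sigma>"
    and u: "u \<noteq> []" and v: "v \<noteq> []" and sat: "satisfies (cyclic_semigroup h d) (u, v)"
  shows "(u, v) \<in> consequences \<Sigma>"
proof -
  note cong = satisfies_cong[OF h d u v sat]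
  have "length u = length v \<or> h \<le> length u \<and> h \<le> length v"
    using satisfies_length[OF h d u v sat] by (auto simp: reduce_exp_eq_iff[OF d])
  then consider (long) "h \<le> length u" "h \<le> length v" | (short) "length u = length v" "length u < h"
    by linarith
  then show ?thesis
  proof cases
    case long
    then show ?thesis using long_words[OF Com Phi h d] cong by blast
  next
    case short
    define r where "r = h - length u"
    have r: "0 < r" "length u + r = h" "length v + r = h"
      using short by (simp_all add: r_def)
    moreover have "r \<le> count (mset u) z \<and> r \<le> count (mset v) z"
      if "count (mset u) z \<noteq> count (mset v) z" for z
      using satisfies_count[OF h d u v sat, of z] that short r
      by (auto simp: reduce_exp_eq_iff[OF d])
    ultimately show ?thesis
      using short_words[OF Com d r(1) Psi[OF r(1)] u] cong by blast
  qed
qed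

theorem mainTheorem1:
  fixes h d :: nat
  assumes "0 < h" and "0 < d"
  shows "(h \<le> d + 2 \<longrightarrow> identity_basis (cyclic_semigroup h d) {Com, Phi h d}) \<and>
         (h > d + 2 \<longrightarrow> identity_basis (cyclic_semigroup h d)
            ({Com, Phi h d} \<union> {Psi h d r | r. 1 \<le> r \<and> r \<le> (h - d) div 3}))"
proof -
  have Com_Phi: "is_identity Com" "is_identity (Phi h d)"
    using assms(1) by (simp_all add: is_identity_def Com_def Phi_def xs_word_def)
  have Psi: "is_identity (Psi h d r)" if "1 \<le> r" for r
    using that by (simp add: is_identity_def Psi_def)
  note sat = satisfies_Com[OF assms] satisfies_Phi[OF assms]
  note complete = satisfies_imp_consequence[OF assms]
  show ?thesis
  proof (intro conjI impI)
    assume "h \<le> d + 2"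
    then have "(u, v) \<in> consequences {Com, Phi h d}"
      if "u \<noteq> []" "v \<noteq> []" "satisfies (cyclic_semigroup h d) (u, v)" for u v
      using that by (intro complete) auto
    then show "identity_basis (cyclic_semigroup h d) {Com, Phi h d}"
      using Com_Phi sat by (auto simp: identity_basis_def is_identity_def)
  next
    assume hd: "d + 2 < h"
    let ?\<Sigma> = "{Com, Phi h d} \<union> {Psi h d r | r. 1 \<le> r \<and> r \<le> (h - d) div 3}"
    have range: "r \<le> (h - d) div 3 \<longleftrightarrow> 3 * r + d \<le> h" for r
      using hd by linarith
    have "(u, v) \<in> consequences ?\<Sigma>"
      if "u \<noteq> []" "v \<noteq> []" "satisfies (cyclic_semigroup h d) (u, v)" for u v
      using that by (intro complete) (auto simp: range Suc_le_eq)
    moreover have "is_identity e \<and> satisfies (cyclic_semigroup h d) e" if "e \<in> ?\<Sigma>" for e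
      using that Com_Phi sat Psi satisfies_Psi[OF assms] by (auto simp: range Suc_le_eq)
    ultimately show "identity_basis (cyclic_semigroup h d) ?\<Sigma>"
      unfolding identity_basis_def is_identity_def by (simp only: split_paired_All) simp
  qed
qed

end
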